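(* For any positive integer $k$ and any positive real number $x$, $$Q_{2k}(x)\ge (x+1)^{K},\qquad Q_{2k-1}(x)\ge x(x+1)^{L},$$ where $K=[\sqrt{k}]$ and $L=\left[\dfrac{-1+\sqrt{1+4k}}{2}\right]$.
   Context: $[y]$ denotes the integer part (floor) of a real number $y$. For an integer $m\ge1$ let $c_m=c_m(x)$ be $x$ if $m$ is odd and $\frac{2}{m}$ if $m$ is even. The polynomials $Q_n(x)$ are defined by $Q_{-1}(x)=0$, $Q_0(x)=1$, and $Q_n(x)=c_nQ_{n-1}(x)+Q_{n-2}(x)$ for $n\ge1$. *)

theory Defs
  imports Complex_Main "HOL-Computational_Algebra.Polynomial"
begin

definition c :: "int \<Rightarrow> real poly" where
  "c m = (if odd m then [:0, 1:] else [:2 / of_int m:])"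

(* Indexed by the integers so that the initial value at -1 is literally present;
   the value 0 below -1 only makes the function total. *)
function Q :: "int \<Rightarrow> real poly" where
  "Q n = (if n \<le> -1 then 0 else if n = 0 then 1 else c n * Q (n - 1) + Q (n - 2))"
  by pat_completeness auto
termination by (relation "measure (\<lambda>n. nat (n + 1))") auto

declare Q.simps [simp del]

lemma Q_minus_one: "Q (-1) = 0"
  by (simp add: Q.simps)

lemma Q_zero: "Q 0 = 1"
  by (simp add: Q.simps)

lemma Q_rec: "n \<ge> 1 \<Longrightarrow> Q n = c n * Q (n - 1) + Q (n - 2)"
  by (subst Q.simps) simp

end

theory Submission
  imports Defs
begin

text \<open>
  The values \<open>Q\<^sub>2\<^sub>k(x)\<close> are Laguerre polynomials at \<open>-x\<close>: they equal \<open>\<Sum>m. (k choose m) x\<^sup>m / m!\<close>,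
  and \<open>Q\<^sub>2\<^sub>k\<^sub>-\<^sub>1(x) = x \<Sum>m. (k choose (m + 1)) x\<^sup>m / m!\<close>. Both bounds therefore hold
  coefficient by coefficient, by \<open>m! (n choose m) \<le> (k choose m)\<close> for \<open>n\<^sup>2 \<le> k\<close>; for the odd
  index this is applied to \<open>k - 1\<close> through \<open>(m + 1) (k choose (m + 1)) = k (k - 1 choose m)\<close>.
\<close>

lemma poly_Q_odd_Suc:
  "poly (Q (2 * int (Suc k) - 1)) x = x * poly (Q (2 * int k)) x + poly (Q (2 * int k - 1)) x"
proof -
  have "Q (2 * int (Suc k) - 1) = c (2 * int (Suc k) - 1) * Q (2 * int k) + Q (2 * int k - 1)"
    by (subst Q_rec) (simp_all add: algebra_simps)
  then show ?thesis by (simp add: c_def)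
qed

lemma poly_Q_even_Suc:
  "poly (Q (2 * int (Suc k))) x
    = poly (Q (2 * int (Suc k) - 1)) x / real (Suc k) + poly (Q (2 * int k)) x"
proof -
  have "Q (2 * int (Suc k)) = c (2 * int (Suc k)) * Q (2 * int (Suc k) - 1) + Q (2 * int k)"
    by (subst Q_rec) (simp_all add: algebra_simps)
  moreover have "poly (c (2 * int (Suc k))) x = 1 / real (Suc k)"
    by (simp add: c_def field_simps)
  ultimately show ?thesis by simp
qed

text \<open>The recursion alternates parities, so both formulas go through one induction: the odd
  value at \<open>Suc k\<close> comes from the two values at \<open>k\<close> by Pascal's rule, and
  the even value follows from it. The odd sum keeps a vanishing top term so that both sums share one
  range.\<close>

lemma poly_Q_closed_form:
  "poly (Q (2 * int k)) x = (\<Sum>m\<le>k. real (k choose m) * x ^ m / fact m)"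
  "poly (Q (2 * int k - 1)) x = x * (\<Sum>m\<le>k. real (k choose Suc m) * x ^ m / fact m)"
proof (induction k)
  case 0
  {
    case 1
    show ?case by (simp add: Q_zero)
  next
    case 2
    show ?case by (simp add: Q_minus_one)
  }
next
  case (Suc k)
  have odd_case: "poly (Q (2 * int (Suc k) - 1)) x
      = x * (\<Sum>m\<le>k. real (Suc k choose Suc m) * x ^ m / fact m)"
    unfolding poly_Q_odd_Suc Suc.IH
    by (simp add: sum.distrib ring_distribs add_divide_distrib)
  \<comment> \<open>Absorption trades the divisor \<open>k + 1\<close>, which is the coefficient 2 /
    (2k + 2), for \<open>m + 1\<close>, and this turns \<open>fact m\<close> into
    \<open>fact (Suc m)\<close>.\<close>
  have quot: "real (Suc k choose Suc m) / real (Suc k) = real (k choose m) / real (Suc m)" for m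
    using Suc_times_binomial_eq[of k m]
    by (simp add: field_simps flip: of_nat_mult of_nat_Suc)
  have "poly (Q (2 * int (Suc k) - 1)) x / real (Suc k)
      = (\<Sum>m\<le>k. real (Suc k choose Suc m) / real (Suc k) * x ^ Suc m / fact m)"
    unfolding odd_case by (simp add: sum_distrib_left sum_divide_distrib mult_ac)
  also have "\<dots> = (\<Sum>m\<le>k. real (k choose m) * x ^ Suc m / fact (Suc m))"
    unfolding quot by (simp add: mult_ac)
  finally have step: "poly (Q (2 * int (Suc k) - 1)) x / real (Suc k)
      = (\<Sum>m\<le>k. real (k choose m) * x ^ Suc m / fact (Suc m))" .
  \<comment> \<open>A zero term at \<open>m = Suc k\<close> is appended and the constant term split
    off, so that the rest matches \<open>step\<close> index by index for Pascal's rule.\<close>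
  have "poly (Q (2 * int k)) x = (\<Sum>m\<le>Suc k. real (k choose m) * x ^ m / fact m)"
    by (simp add: Suc.IH)
  also have "\<dots> = 1 + (\<Sum>m\<le>k. real (k choose Suc m) * x ^ Suc m / fact (Suc m))"
    by (subst sum.atMost_Suc_shift) simp
  finally have shifted: "poly (Q (2 * int k)) x
      = 1 + (\<Sum>m\<le>k. real (k choose Suc m) * x ^ Suc m / fact (Suc m))" .
  {
    case 1
    have "poly (Q (2 * int (Suc k))) x
        = 1 + (\<Sum>m\<le>k. real (Suc k choose Suc m) * x ^ Suc m / fact (Suc m))"
      unfolding poly_Q_even_Suc step shifted
      by (simp add: sum.distrib ring_distribs add_divide_distrib del: fact_Suc power_Suc)
    also have "\<dots> = (\<Sum>m\<le>Suc k. real (Suc k choose m) * x ^ m / fact m)"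
      by (subst sum.atMost_Suc_shift) simp
    finally show ?case .
  next
    case 2
    show ?case unfolding odd_case by (simp add: binomial_eq_0)
  }
qed

text \<open>Going from \<open>m\<close> to \<open>m + 1\<close> multiplies the left side by
  \<open>n - m\<close> and the right side by \<open>(k - m) / (m + 1)\<close>, so it suffices that
  \<open>(m + 1) * (n - m) \<le> k - m\<close>.\<close>

lemma fact_times_binomial_le_binomial:
  fixes n k :: nat
  assumes "n ^ 2 \<le> k"
  shows "fact m * (n choose m) \<le> k choose m"
proof (induction m)
  case 0
  show ?case by simp
next
  case (Suc m)
  have absorb: "Suc m * (r choose Suc m) = (r - m) * (r choose m)" for r :: nat
    by (simp only: binomial_absorption binomial_absorb_comp)
  have factor: "Suc m * (n - m) \<le> k - m"
  proof (cases "m < n")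
    case True
    then obtain d where d: "n = Suc (m + d)"
      using less_iff_Suc_add by auto
    \<comment> \<open>With \<open>n = m + 1 + d\<close> the difference of the two sides is
      \<open>m^2 + (m + 1) * d + d^2\<close>. When \<open>m \<ge> n\<close>, truncated subtraction
      makes \<open>factor\<close> trivial.\<close>
    have "Suc m * (n - m) + m \<le> n ^ 2"
      by (simp add: d power2_eq_square algebra_simps)
    with assms show ?thesis by simp
  qed simp
  have "Suc m * (fact (Suc m) * (n choose Suc m)) = Suc m * fact m * (Suc m * (n choose Suc m))"
    by (simp only: fact_Suc of_nat_id mult_ac)
  also have "\<dots> = (Suc m * (n - m)) * (fact m * (n choose m))"
    unfolding absorb by (simp only: mult_ac)
  also have "\<dots> \<le> (k - m) * (k choose m)"
    by (rule mult_mono[OF factor Suc.IH]) auto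
  also have "\<dots> = Suc m * (k choose Suc m)"
    by (rule absorb[symmetric])
  finally show ?case by (simp only: Suc_mult_le_cancel1)
qed

lemma fact_times_binomial_le_binomial_Suc:
  fixes n k :: nat
  assumes "n * (n + 1) \<le> k" and "k \<ge> 1"
  shows "fact m * (n choose m) \<le> k choose Suc m"
proof (cases "m \<le> n")
  case True
  \<comment> \<open>If \<open>n \<ge> 1\<close>, then \<open>n^2 \<le> k - n \<le> k - 1\<close> and
    \<open>n + 1 \<le> n * (n + 1) \<le> k\<close>; if \<open>n = 0\<close>, both say
    \<open>k \<ge> 1\<close>. The second bound gives \<open>Suc m \<le> k\<close> for
    \<open>m \<le> n\<close>.\<close>
  have "n ^ 2 \<le> k - 1" and "Suc n \<le> k"
    using assms by (cases n; simp add: power2_eq_square)+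
  then have "Suc m * (fact m * (n choose m)) \<le> k * (k - 1 choose m)"
    using True by (intro mult_mono fact_times_binomial_le_binomial) auto
  also have "\<dots> = Suc m * (k choose Suc m)"
    by (rule binomial_absorption[symmetric])
  finally show ?thesis by (simp only: Suc_mult_le_cancel1)
qed (simp add: binomial_eq_0)

text \<open>Coefficientwise comparison with the binomial expansion. The sequence \<open>a\<close> is
  left general to cover both \<open>k choose m\<close> and \<open>k choose Suc m\<close>.\<close>

lemma power_one_add_le_sum:
  fixes x :: real and a :: "nat \<Rightarrow> nat"
  assumes "x \<ge> 0" and "n \<le> k" and "\<And>m. fact m * (n choose m) \<le> a m"
  shows "(x + 1) ^ n \<le> (\<Sum>m\<le>k. real (a m) * x ^ m / fact m)"
proof -
  have coeff: "real (n choose m) \<le> real (a m) / fact m" for m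
  proof -
    have "real (fact m * (n choose m)) \<le> real (a m)"
      using assms(3) of_nat_le_iff by blast
    then show ?thesis by (simp add: field_simps)
  qed
  have "(x + 1) ^ n = (\<Sum>m\<le>n. real (n choose m) * x ^ m)"
    by (simp add: binomial_ring)
  also have "\<dots> \<le> (\<Sum>m\<le>n. real (a m) / fact m * x ^ m)"
    by (intro sum_mono mult_right_mono coeff) (simp add: assms)
  also have "\<dots> \<le> (\<Sum>m\<le>k. real (a m) / fact m * x ^ m)"
    by (rule sum_mono2) (use assms in auto)
  finally show ?thesis by simp
qed

theorem theorem4p1:
  fixes k :: nat and x :: real
  assumes "k \<ge> 1" and "x > 0"
  shows "poly (Q (2 * int k)) x \<ge> (x + 1) ^ nat \<lfloor>sqrt (real k)\<rfloor>
       \<and> poly (Q (2 * int k - 1)) x \<ge> x * (x + 1) ^ nat \<lfloor>(- 1 + sqrt (1 + 4 * real k)) / 2\<rfloor>"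
proof
  define K where "K = nat \<lfloor>sqrt (real k)\<rfloor>"
  have "real K \<le> sqrt (real k)"
    unfolding K_def by simp
  then have "real K ^ 2 \<le> real k"
    by (metis of_nat_0_le_iff power_mono real_sqrt_pow2)
  then have K: "K ^ 2 \<le> k"
    by (simp flip: of_nat_power)
  then have "K \<le> k"
    using power2_nat_le_imp_le by blast
  then have "(x + 1) ^ K \<le> (\<Sum>m\<le>k. real (k choose m) * x ^ m / fact m)"
    using assms K by (intro power_one_add_le_sum fact_times_binomial_le_binomial) auto
  then show "(x + 1) ^ nat \<lfloor>sqrt (real k)\<rfloor> \<le> poly (Q (2 * int k)) x"
    by (simp add: poly_Q_closed_form K_def)
next
  define L where "L = nat \<lfloor>(- 1 + sqrt (1 + 4 * real k)) / 2\<rfloor>"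
  \<comment> \<open>This makes the argument of the floor nonnegative, so \<open>nat\<close> does not
    truncate. That argument is the positive root of t(t + 1) = k, whence
    \<open>L * (L + 1) \<le> k\<close>.\<close>
  have "1 \<le> sqrt (1 + 4 * real k)"
    by simp
  then have "real L \<le> (- 1 + sqrt (1 + 4 * real k)) / 2"
    unfolding L_def by (intro of_nat_floor) simp
  then have "2 * real L + 1 \<le> sqrt (1 + 4 * real k)"
    by simp
  then have "(2 * real L + 1) ^ 2 \<le> sqrt (1 + 4 * real k) ^ 2"
    by (rule power_mono) simp
  then have "real (L * (L + 1)) \<le> real k"
    by (simp add: power2_eq_square algebra_simps)
  then have L: "L * (L + 1) \<le> k"
    by (simp only: of_nat_le_iff)
  then have "L \<le> k"
    by (cases L) auto
  then have "(x + 1) ^ L \<le> (\<Sum>m\<le>k. real (k choose Suc m) * x ^ m / fact m)"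
    using assms L by (intro power_one_add_le_sum fact_times_binomial_le_binomial_Suc) auto
  then show "x * (x + 1) ^ nat \<lfloor>(- 1 + sqrt (1 + 4 * real k)) / 2\<rfloor> \<le> poly (Q (2 * int k - 1)) x"
    using assms(2) by (simp add: poly_Q_closed_form L_def)
qed

end
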